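(* Let $n$ be a positive integer. Then every group consisting of exactly $n$ elements is cyclic if and only if $n$ and $\phi(n)$ are coprime, where $\phi(n)$ denotes the number of positive integers not exceeding $n$ and coprime to $n$ (the Euler function).
   Context: A group here means a nonempty family $G$ of transformations (i.e. permutations, bijections of the set to itself) of some set that is closed under composition and under taking inverses: if $f,g\in G$, then $f\circ g\in G$ and $f^{-1}\in G$. (By Cayley's theorem, this is equivalent, up to isomorphism, to the usual abstract notion of a group.) A finite group $G$ is called cyclic if it contains an element $g$ such that $G$ consists of all powers of $g$, i.e. $G=\{g,g^2,\dots,g^n,\dots\}$. *)

theory Defs
  imports "HOL-Combinatorics.Permutations" "HOL-Number_Theory.Totient"
begin

(* Transformations of X are represented by functions on the ambient type that are the
   identity outside X.  Each bijection of X to itself is then exactly one function, so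
   card G counts transformations, and (o) and inv are composition and inverse on X. *)
definition transformation_group :: "'a set \<Rightarrow> ('a \<Rightarrow> 'a) set \<Rightarrow> bool" where
  "transformation_group X G \<longleftrightarrow>
     G \<noteq> {} \<and>
     (\<forall>f\<in>G. f permutes X) \<and>
     (\<forall>f\<in>G. \<forall>g\<in>G. f \<circ> g \<in> G) \<and>
     (\<forall>f\<in>G. inv f \<in> G)"

(* Only positive powers are listed, so this is the notion of cyclicity for finite G only. *)
definition cyclic_transformation_group :: "('a \<Rightarrow> 'a) set \<Rightarrow> bool" where
  "cyclic_transformation_group G \<longleftrightarrow> (\<exists>g\<in>G. G = {g ^^ k |k. k \<ge> 1})"

end

(* Suppose n is coprime to phi(n); then n is squarefree, and by induction all proper subgroups of a
   group G of order n are cyclic.  If G is not abelian, counting conjugates of centralizers yields a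
   noncentral element whose centralizer A is normal.  A is cyclic, and G acts on it through a group
   of order phi(|A|), which is coprime to n, so A is central, a contradiction.  Hence G is abelian of
   squarefree order, so it is cyclic.

   Conversely, a prime p dividing both n and phi(n) gives a noncyclic semidirect product of Z/m by
   Z/p, m = n/p: with the trivial action if p divides m; otherwise p divides phi(m), and Z/p can act
   through a unit of order p modulo m. *)

theory Submission
  imports Defs "HOL-Number_Theory.Residues" "HOL-Number_Theory.Pocklington" "HOL-Algebra.Sylow"
    "HOL-Computational_Algebra.Squarefree"
begin

section \<open>Consequences of coprimality with the totient\<close>

section \<open>Arithmetic\<close>

text \<open>The multiplicative order of \<open>k\<close> modulo \<open>d\<close> divides both
  \<open>n\<close> and \<open>totient d\<close>, which are coprime, so it is 1.\<close>

lemma cong_1_if_power_cong_1_coprime_totient: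
  fixes k n d :: nat
  assumes "n > 0" "coprime n (totient d)" "[k ^ n = 1] (mod d)"
  shows "[k = 1] (mod d)"
proof -
  have n: "Pocklington.ord d k dvd n"
    using assms(3) by (simp only: ord_divides)
  have "coprime d k"
  proof (rule ccontr)
    \<comment> \<open>For \<open>k\<close> not coprime to \<open>d\<close> the order is 0 by
      convention, and 0 does not divide the positive \<open>n\<close>.\<close>
    assume "\<not> coprime d k"
    then have "Pocklington.ord d k = 0" by (simp add: Pocklington.ord_eq_0)
    with n \<open>n > 0\<close> show False by simp
  qed
  then have "Pocklington.ord d k dvd totient d"
    by (rule order_divides_totient)
  with n assms(2) have "Pocklington.ord d k = 1"
    by (metis coprime_common_divisor_nat)
  then show ?thesis
    using ord_divides[of k 1 d] by simp
qed

text \<open>If \<open>p ^ 2\<close> divides \<open>n\<close> for a prime \<open>p\<close>, then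
  \<open>p\<close> divides \<open>totient (p ^ 2)\<close>, hence \<open>totient n\<close>, as well
  as \<open>n\<close>.\<close>

lemma squarefree_if_coprime_totient:
  fixes n :: nat
  assumes "coprime n (totient n)"
  shows "squarefree n"
proof (rule squarefreeI)
  fix x :: nat
  assume x: "x ^ 2 dvd n"
  show "x dvd 1"
  proof (rule ccontr)
    assume "\<not> x dvd 1"
    then obtain p where p: "prime p" "p dvd x"
      using prime_factor_nat[of x] by auto
    then have "p ^ 2 dvd n"
      using x by (meson dvd_trans dvd_power_same)
    then have "totient (p ^ 2) dvd totient n" "p dvd n"
      by (auto intro: totient_dvd simp: power2_eq_square dest: dvd_mult_left)
    moreover have "p dvd totient (p ^ 2)"
      using p by (simp add: totient_prime_power)
    ultimately show False
      using assms p(1) by (meson coprime_common_divisor dvd_trans not_prime_unit)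
  qed
qed

section \<open>Cauchy's theorem and abelian groups of squarefree order\<close>

section \<open>Cyclic groups\<close>

context group
begin

text \<open>Cauchy's theorem: Sylow with exponent 1 gives a subgroup of prime order
  \<open>p\<close>, in which every nonidentity element has order \<open>p\<close>.\<close>

lemma exists_ord_eq_prime:
  assumes "finite (carrier G)" "Factorial_Ring.prime p" "p dvd order G"
  shows "\<exists>x\<in>carrier G. ord x = p"
proof -
  obtain m where "order G = p ^ 1 * m"
    using assms(3) by auto
  then obtain H where H: "subgroup H G" "card H = p"
    using sylow_thm[OF assms(2) is_group _ assms(1), of 1 m] by auto
  interpret H: group "G\<lparr>carrier := H\<rparr>"
    using H(1) by (rule subgroup.subgroup_is_group) (rule is_group)
  have "p > 1"
    using assms(2) prime_gt_1_nat by blast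
  then have "\<not> H \<subseteq> {\<one>}"
    using H(2) card_mono[of "{\<one>}" H] by auto
  then obtain x where x: "x \<in> H" "x \<noteq> \<one>"
    by blast
  have "x [^]\<^bsub>G\<lparr>carrier := H\<rparr>\<^esub> p = \<one>"
    using H.pow_order_eq_1[of x] x H(2) by (simp add: order_def)
  then have "x [^] p = \<one>"
    by (simp flip: nat_pow_consistent)
  moreover have xc: "x \<in> carrier G"
    using x(1) H(1) subgroup.mem_carrier by fast
  ultimately have "ord x dvd p"
    by (simp add: pow_eq_id)
  moreover have "ord x \<noteq> 1"
    using x ord_eq_1[OF xc] by simp
  ultimately have "ord x = p"
    using assms(2) by (metis prime_nat_iff)
  with xc show ?thesis by blast
qed

end

text \<open>An element \<open>x\<close> of maximal order works. If a prime \<open>p\<close> divided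
  the cofactor \<open>c\<close>, squarefreeness would make \<open>p\<close> coprime to
  \<open>ord x\<close>, and the product of \<open>x\<close> with an element of order
  \<open>p\<close> would have larger order.\<close>

lemma (in comm_group) exists_ord_eq_order_if_squarefree:
  assumes fin: "finite (carrier G)" and sqf: "squarefree (order G)"
  shows "\<exists>x\<in>carrier G. ord x = order G"
proof -
  have "finite (ord ` carrier G)" "ord ` carrier G \<noteq> {}"
    using fin by auto
  then have "Max (ord ` carrier G) \<in> ord ` carrier G"
    by (rule Max_in)
  then obtain x where x: "x \<in> carrier G" and "ord x = Max (ord ` carrier G)"
    by auto
  with fin have max: "ord y \<le> ord x" if "y \<in> carrier G" for y
    using that by simp
  obtain c where c: "order G = ord x * c"
    using ord_dvd_group_order[OF x] by auto
  have pos: "order G > 0"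
    using fin by (simp add: order_gt_0_iff_finite)
  have "c = 1"
  proof (rule ccontr)
    assume "c \<noteq> 1"
    then obtain p where p: "Factorial_Ring.prime p" "p dvd c"
      using prime_factor_nat by blast
    then have "p dvd order G" using c by simp
    then obtain y where y: "y \<in> carrier G" "ord y = p"
      using exists_ord_eq_prime fin p(1) by blast
    have cop: "coprime (ord x) p"
    proof (rule ccontr)
      assume "\<not> coprime (ord x) p"
      then have "p dvd ord x"
        using p(1) by (metis coprime_commute prime_imp_coprime)
      then have "p ^ 2 dvd order G"
        using p(2) c by (simp add: power2_eq_square mult_dvd_mono)
      then show False
        using sqf p(1) by (meson squarefreeD not_prime_unit)
    qed
    define k where "k = ord (x \<otimes> y)"
    have 1: "x [^] k \<otimes> y [^] k = \<one>"
      using pow_mult_distrib[OF m_comm[OF x y(1)] x y(1), of k] pow_ord_eq_1[of "x \<otimes> y"] x y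
      by (simp add: k_def)
    have "(x [^] k \<otimes> y [^] k) [^] j = x [^] (k * j) \<otimes> y [^] (k * j)" for j :: nat
      using x y pow_mult_distrib[OF m_comm[of "x [^] k" "y [^] k"], of j] by (simp add: nat_pow_pow)
    with 1 have 2: "x [^] (k * j) \<otimes> y [^] (k * j) = \<one>" for j :: nat
      by simp
    have "y [^] (k * p) = \<one>" "x [^] (k * ord x) = \<one>"
      using x y by (simp_all add: pow_eq_id)
    \<comment> \<open>The exponent \<open>k * p\<close> kills the power of \<open>y\<close> and
      \<open>k * ord x\<close> kills that of \<open>x\<close>, so in each case the other factor is
      also trivial.\<close>
    with 2[of p] 2[of "ord x"] have "ord x dvd k * p" "p dvd k * ord x"
      using x y by (simp_all add: pow_eq_id)
    then have "ord x dvd k" "p dvd k"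
      using cop by (simp_all add: coprime_dvd_mult_left_iff coprime_commute)
    then have "ord x * p dvd k"
      using cop by (simp add: divides_mult)
    moreover have "k > 0"
      unfolding k_def using x y fin ord_ge_1[OF fin, of "x \<otimes> y"] by simp
    ultimately have "ord x * p \<le> k"
      by (simp add: dvd_imp_le)
    also have "k \<le> ord x"
      unfolding k_def using x y by (intro max) simp
    finally have "ord x * p \<le> ord x" .
    then show False
      using prime_gt_1_nat[OF p(1)] c pos by simp
  qed
  with c x show ?thesis by auto
qed

section \<open>Conjugation, centralizers and the center\<close>

definition (in group) conjugate :: "'a \<Rightarrow> 'a \<Rightarrow> 'a" where
  "conjugate g x = g \<otimes> x \<otimes> inv g"

definition (in group) centralizer :: "'a \<Rightarrow> 'a set" where
  "centralizer x = {g \<in> carrier G. g \<otimes> x = x \<otimes> g}"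

definition (in group) center :: "'a set" where
  "center = {z \<in> carrier G. \<forall>g\<in>carrier G. g \<otimes> z = z \<otimes> g}"

context group
begin

lemma conjugate_closed [simp]:
  "g \<in> carrier G \<Longrightarrow> x \<in> carrier G \<Longrightarrow> conjugate g x \<in> carrier G"
  by (simp add: conjugate_def)

lemma conjugate_one [simp]: "x \<in> carrier G \<Longrightarrow> conjugate \<one> x = x"
  by (simp add: conjugate_def)

lemma conjugate_conjugate:
  "g \<in> carrier G \<Longrightarrow> h \<in> carrier G \<Longrightarrow> x \<in> carrier G \<Longrightarrow>
   conjugate g (conjugate h x) = conjugate (g \<otimes> h) x"
  by (simp add: conjugate_def inv_mult_group m_assoc)

lemma conjugate_mult:
  "g \<in> carrier G \<Longrightarrow> x \<in> carrier G \<Longrightarrow> y \<in> carrier G \<Longrightarrow>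
   conjugate g (x \<otimes> y) = conjugate g x \<otimes> conjugate g y"
  by (simp add: conjugate_def inv_solve_left m_assoc)

lemma conjugate_pow:
  "g \<in> carrier G \<Longrightarrow> x \<in> carrier G \<Longrightarrow> conjugate g (x [^] (k::nat)) = conjugate g x [^] k"
  by (induction k) (simp_all add: conjugate_mult, simp add: conjugate_def)

lemma conjugate_inv_conjugate [simp]:
  "g \<in> carrier G \<Longrightarrow> x \<in> carrier G \<Longrightarrow> conjugate (inv g) (conjugate g x) = x"
  "g \<in> carrier G \<Longrightarrow> x \<in> carrier G \<Longrightarrow> conjugate g (conjugate (inv g) x) = x"
  by (simp_all add: conjugate_conjugate)

lemma conjugate_inject:
  "g \<in> carrier G \<Longrightarrow> x \<in> carrier G \<Longrightarrow> y \<in> carrier G \<Longrightarrow>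
   conjugate g x = conjugate g y \<longleftrightarrow> x = y"
  by (metis conjugate_inv_conjugate(1))

lemma conjugate_eq_self_iff:
  "g \<in> carrier G \<Longrightarrow> x \<in> carrier G \<Longrightarrow> conjugate g x = x \<longleftrightarrow> g \<in> centralizer x"
  by (auto simp: conjugate_def centralizer_def inv_solve_right')

lemma subgroup_centralizer:
  assumes x: "x \<in> carrier G"
  shows "subgroup (centralizer x) G"
proof (rule subgroupI)
  show "centralizer x \<subseteq> carrier G" "centralizer x \<noteq> {}"
    using x by (auto simp: centralizer_def)
  fix g h assume g: "g \<in> centralizer x" and h: "h \<in> centralizer x"
  then have c: "g \<in> carrier G" "h \<in> carrier G"
    by (auto simp: centralizer_def)
  have gx: "conjugate g x = x" and "conjugate h x = x"
    using g h c x by (simp_all add: conjugate_eq_self_iff)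
  then have "conjugate (g \<otimes> h) x = x"
    using c x by (simp flip: conjugate_conjugate)
  then show "g \<otimes> h \<in> centralizer x"
    using c x by (simp add: conjugate_eq_self_iff)
  have "conjugate (inv g) x = x"
    using conjugate_inv_conjugate(1)[of g x] gx c x by simp
  then show "inv g \<in> centralizer x"
    using c x by (simp add: conjugate_eq_self_iff)
qed

text \<open>Conjugation by \<open>g\<close> is an injective homomorphism, so it preserves and
  reflects commutation.\<close>

lemma centralizer_conjugate_iff:
  assumes "g \<in> carrier G" "h \<in> carrier G" "x \<in> carrier G"
  shows "conjugate g h \<in> centralizer (conjugate g x) \<longleftrightarrow> h \<in> centralizer x"
  using assms by (simp add: centralizer_def conjugate_inject flip: conjugate_mult)

lemma conjugate_mem_center_iff:
  assumes "g \<in> carrier G" "x \<in> carrier G"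
  shows "conjugate g x \<in> center \<longleftrightarrow> x \<in> center"
proof -
  have *: "conjugate g x = x" if "x \<in> center" "g \<in> carrier G" for g x
    using that by (subst conjugate_eq_self_iff) (auto simp: center_def centralizer_def)
  show ?thesis
    using *[of "conjugate g x" "inv g"] *[of x g] assms by auto
qed

text \<open>If \<open>g a g\<inverse> = a\<^sup>k\<close> and \<open>n\<close> is the order of the group, then \<open>a = g\<^sup>n a g\<^sup>-\<^sup>n = a\<^bsup>k^n\<^esup>\<close>, so
  the class of \<open>k\<close> is a unit modulo the order of \<open>a\<close> whose order divides both \<open>n\<close> and \<open>\<phi>(ord a)\<close>.\<close>
lemma conjugate_eq_self_if_coprime_totient:
  assumes fin: "finite (carrier G)"
    and g: "g \<in> carrier G" and a: "a \<in> carrier G"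
    and k: "conjugate g a = a [^] (k::nat)"
    and cop: "coprime (order G) (totient (ord a))"
  shows "conjugate g a = a"
proof -
  have eq: "conjugate (g [^] j) a = a [^] (k ^ j)" for j :: nat
  proof (induction j)
    case (Suc j)
    have "conjugate (g [^] Suc j) a = conjugate (g [^] j) (a [^] k)"
      using g a by (simp flip: k conjugate_conjugate)
    also have "\<dots> = (a [^] (k ^ j)) [^] k"
      using g a Suc by (simp add: conjugate_pow)
    finally show ?case
      using a by (simp add: nat_pow_pow mult.commute)
  qed (use a in simp)
  have cong: "a [^] i = a [^] j \<longleftrightarrow> [i = j] (mod ord a)" for i j :: nat
    using int_pow_eq[OF a, of "int i" "int j"] a
    by (simp add: int_pow_int cong_iff_dvd_diff dvd_diff_commute flip: cong_int_iff)
  have "a [^] (k ^ order G) = a [^] (1::nat)"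
    using eq[of "order G"] g a by (simp add: pow_order_eq_1)
  then have "[k ^ order G = 1] (mod ord a)"
    by (simp only: cong)
  moreover have "order G > 0"
    using fin by (simp add: order_gt_0_iff_finite)
  ultimately have "[k = 1] (mod ord a)"
    using cop by (blast intro: cong_1_if_power_cong_1_coprime_totient[of "order G"])
  then have "a [^] k = a [^] (1::nat)"
    by (simp only: cong)
  with k a show ?thesis by simp
qed


section \<open>A normal centralizer, and the induction on the order\<close>

text \<open>When all proper subgroups are abelian, the centralizers of noncentral elements partition the
  noncentral elements. If no such centralizer \<open>A\<close> were normal, each would be its own normalizer and
  the conjugates of \<open>A\<close> would cover \<open>[G : A] (|A| - |Z|)\<close> noncentral elements, which is at least
  half of \<open>G\<close> but not all noncentral elements: the conjugates of two inequivalent centralizers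
  would be too many.\<close>
lemma exists_noncentral_normal_centralizer:
  assumes fin: "finite (carrier G)"
    and noncomm: "center \<noteq> carrier G"
    and proper: "\<And>H x y. subgroup H G \<Longrightarrow> H \<noteq> carrier G \<Longrightarrow> x \<in> H \<Longrightarrow> y \<in> H \<Longrightarrow> x \<otimes> y = y \<otimes> x"
  shows "\<exists>x\<in>carrier G - center. \<forall>g\<in>carrier G. \<forall>a\<in>centralizer x. conjugate g a \<in> centralizer x"
proof (rule ccontr)
  assume no: "\<not> ?thesis"
  have centralizer_sub: "centralizer x \<subseteq> carrier G" for x
    by (auto simp: centralizer_def)
  have center_sub: "center \<subseteq> centralizer x" if "x \<in> carrier G" for x
    using that by (auto simp: center_def centralizer_def)
  have self: "x \<in> centralizer x" if "x \<in> carrier G" for x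
    using that by (auto simp: centralizer_def)
  have ne: "centralizer x \<noteq> carrier G" if "x \<in> carrier G - center" for x
    using that by (force simp: centralizer_def center_def)
  \<comment> \<open>\<open>centralizer x\<close> is a proper subgroup, hence abelian, so all of it
    commutes with its member \<open>z\<close>.\<close>
  have sub: "centralizer x \<subseteq> centralizer z"
    if "x \<in> carrier G - center" "z \<in> centralizer x" for x z
  proof
    fix y assume y: "y \<in> centralizer x"
    have "y \<otimes> z = z \<otimes> y"
      using that y by (intro proper[of "centralizer x"] subgroup_centralizer ne) auto
    then show "y \<in> centralizer z"
      using y by (simp add: centralizer_def)
  qed
  \<comment> \<open>Applying \<open>sub\<close> in both directions: commuting noncentral elements
    have the same centralizer.\<close>
  have eq: "centralizer z = centralizer x"
    if "x \<in> carrier G - center" "z \<in> carrier G - center" "z \<in> centralizer x" for x z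
    using sub[of x z] sub[of z x] that self[of x] by blast
  have self_normalizing: "g \<in> centralizer x"
    if x: "x \<in> carrier G - center" and g: "g \<in> carrier G" "conjugate g x \<in> centralizer x" for x g
  proof -
    \<comment> \<open>\<open>N\<close> is the normalizer of \<open>centralizer x\<close>: by
      \<open>eq\<close> it suffices to test the single element \<open>x\<close>. By
      \<open>no\<close> it is a proper subgroup, hence abelian, and it contains both
      \<open>x\<close> and \<open>g\<close>.\<close>
    define N where "N = {g \<in> carrier G. conjugate g x \<in> centralizer x}"
    have N_eq: "centralizer (conjugate g x) = centralizer x" if "g \<in> N" for g
      using that x by (intro eq) (auto simp: N_def conjugate_mem_center_iff)
    have normalizes: "conjugate g h \<in> centralizer x \<longleftrightarrow> h \<in> centralizer x"
      if "g \<in> N" "h \<in> carrier G" for g h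
      using N_eq[OF that(1)] centralizer_conjugate_iff[of g h x] that x by (auto simp: N_def)
    have "subgroup N G"
    proof (rule subgroupI)
      show "N \<subseteq> carrier G" "N \<noteq> {}"
        using x self[of x] by (auto simp: N_def intro!: exI[of _ \<one>])
      fix g h assume g: "g \<in> N" and h: "h \<in> N"
      then have c: "g \<in> carrier G" "h \<in> carrier G"
        by (auto simp: N_def)
      show "g \<otimes> h \<in> N"
        using normalizes[OF g, of "conjugate h x"] h c x by (auto simp: N_def conjugate_conjugate)
      show "inv g \<in> N"
        using normalizes[OF g, of "conjugate (inv g) x"] c x self[of x] by (auto simp: N_def)
    qed
    moreover have "N \<noteq> carrier G"
    proof
      assume "N = carrier G"
      then have "\<forall>g\<in>carrier G. \<forall>a\<in>centralizer x. conjugate g a \<in> centralizer x"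
        using normalizes centralizer_sub by blast
      with no x show False by blast
    qed
    moreover have "x \<in> N" "g \<in> N"
      using x g by (auto simp: N_def conjugate_def m_assoc centralizer_def)
    ultimately have "g \<otimes> x = x \<otimes> g"
      using proper by blast
    with g show ?thesis by (simp add: centralizer_def)
  qed
  define n where "n = card (carrier G)"
  define z where "z = card center"
  \<comment> \<open>\<open>S x\<close> collects the noncentral elements of all conjugates of
    \<open>centralizer x\<close>.\<close>
  define S where "S x = (\<lambda>(g, a). conjugate g a) ` (carrier G \<times> (centralizer x - center))" for x
  have fin_sub: "finite A" if "A \<subseteq> carrier G" for A
    using that fin by (rule finite_subset)
  have center_carrier: "center \<subseteq> carrier G"
    by (auto simp: center_def)
  have z_pos: "z > 0"
    using fin_sub[OF center_carrier] by (auto simp: z_def card_gt_0_iff center_def)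
  have zn: "z \<le> n"
    unfolding z_def n_def using fin center_carrier by (rule card_mono)
  have S_sub: "S x \<subseteq> carrier G - center" for x
    using centralizer_sub[of x] by (auto simp: S_def conjugate_mem_center_iff subset_iff)
  \<comment> \<open>Double counting of the pairs \<open>(g, a)\<close> with \<open>a\<close>
    noncentral in the centralizer \<open>A\<close>: every value of \<open>conjugate g a\<close> is
    taken exactly \<open>card A\<close> times.\<close>
  have card_S: "card (S x) * card (centralizer x) = n * (card (centralizer x) - z)"
    if x: "x \<in> carrier G - center" for x
  proof -
    define A where "A = centralizer x"
    have A: "subgroup A G"
      using x unfolding A_def by (intro subgroup_centralizer) auto
    have A_sub: "A \<subseteq> carrier G"
      unfolding A_def by (rule centralizer_sub)
    define P where "P = carrier G \<times> (A - center)"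
    define f where "f = (\<lambda>(g, a). conjugate g a)"
    have S: "S x = f ` P"
      by (simp add: S_def P_def f_def A_def)
    have fibre: "card {i \<in> P. f i = s} = card A" if sS: "s \<in> S x" for s
    proof -
      obtain g a where g: "g \<in> carrier G" and a: "a \<in> A" "a \<notin> center" and s: "s = conjugate g a"
        using sS by (auto simp: S_def A_def)
      have ac: "a \<in> carrier G" using a A_sub by blast
      have "centralizer a = centralizer x"
        using x a ac by (intro eq) (auto simp: A_def)
      then have Ca: "centralizer a = A" by (simp add: A_def)
      have "{i \<in> P. f i = s} = (\<lambda>c. (g \<otimes> c, a)) ` A"
      proof (intro equalityI subsetI)
        fix i assume "i \<in> {i \<in> P. f i = s}"
        then obtain h b where i: "i = (h, b)" and h: "h \<in> carrier G" and b: "b \<in> A" "b \<notin> center"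
          and s': "conjugate h b = s"
          by (auto simp: P_def f_def)
        have bc: "b \<in> carrier G" using b A_sub by blast
        define c where "c = inv g \<otimes> h"
        have c: "c \<in> carrier G" "h = g \<otimes> c"
          using g h by (auto simp: c_def simp flip: m_assoc)
        have cb: "conjugate c b = a"
          using s' s g c bc ac by (simp add: conjugate_inject flip: conjugate_conjugate)
        have "centralizer b = centralizer x"
          using x b bc by (intro eq) (auto simp: A_def)
        then have Cb: "centralizer b = A" by (simp add: A_def)
        \<comment> \<open>Conjugation by \<open>c\<close> takes \<open>b\<close> to
          \<open>a\<close>, which lies in \<open>centralizer b\<close>, so
          \<open>self_normalizing\<close> applies. Hence \<open>c\<close> fixes \<open>b\<close>,
          and \<open>b = a\<close>.\<close>
        have "c \<in> centralizer b"
          using self_normalizing[of b c] c b bc a cb Cb by simp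
        then have "c \<in> A" "conjugate c b = b"
          using Cb conjugate_eq_self_iff[of c b] c bc by auto
        with cb c i show "i \<in> (\<lambda>c. (g \<otimes> c, a)) ` A"
          by auto
      next
        fix i assume "i \<in> (\<lambda>c. (g \<otimes> c, a)) ` A"
        then obtain c where c: "c \<in> A" and i: "i = (g \<otimes> c, a)"
          by auto
        have cc: "c \<in> carrier G" using c A_sub by blast
        have "conjugate c a = a"
          using conjugate_eq_self_iff[of c a] cc ac c Ca by simp
        then have "f i = s"
          using i s g cc ac by (simp add: f_def flip: conjugate_conjugate)
        then show "i \<in> {i \<in> P. f i = s}"
          using i g cc a by (simp add: P_def)
      qed
      moreover have "inj_on (\<lambda>c. (g \<otimes> c, a)) A"
        using g A_sub by (auto simp: inj_on_def subset_iff)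
      ultimately show ?thesis
        by (simp add: card_image)
    qed
    have finP: "finite P"
      using fin fin_sub[OF A_sub] by (simp add: P_def)
    then have "(\<Sum>i\<in>P. card {j \<in> S x. f i = j}) = card A * card (S x)"
      using fibre by (intro sum_multicount) (auto simp: S)
    moreover have "card {j \<in> S x. f i = j} = 1" if "i \<in> P" for i
    proof -
      have "{j \<in> S x. f i = j} = {f i}" using that by (auto simp: S)
      then show ?thesis by simp
    qed
    moreover have "card P = n * (card A - z)"
      using center_sub[of x] x fin_sub[OF center_carrier]
      by (simp add: P_def n_def z_def card_cartesian_product card_Diff_subset A_def)
    ultimately show ?thesis
      by (simp add: A_def mult.commute)
  qed
  have bounds: "n \<le> 2 * card (S x) \<and> card (S x) < n - z" if x: "x \<in> carrier G - center" for x
  proof -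
    define a where "a = card (centralizer x)"
    have finA: "finite (centralizer x)"
      using centralizer_sub by (rule fin_sub)
    have an: "a < n"
      unfolding a_def n_def using fin centralizer_sub[of x] ne[OF x] by (intro psubset_card_mono) auto
    \<comment> \<open>The coset of the center through \<open>x\<close> lies in
      \<open>centralizer x\<close> and misses the center, so the centralizer has at least
      \<open>2 * z\<close> elements. This gives the lower bound on \<open>S x\<close>; the upper one
      comes from \<open>a < n\<close>.\<close>
    have "z \<le> card (centralizer x - center)"
      unfolding z_def
    proof (rule card_inj_on_le)
      show "inj_on (\<lambda>c. c \<otimes> x) center"
        using x by (auto simp: inj_on_def center_def)
      show "(\<lambda>c. c \<otimes> x) ` center \<subseteq> centralizer x - center"
      proof (rule image_subsetI, rule DiffI)
        fix c assume c: "c \<in> center"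
        then have cc: "c \<in> carrier G" by (simp add: center_def)
        have C: "c \<in> centralizer x" "x \<in> centralizer x" "subgroup (centralizer x) G"
          using x c center_sub[of x] self subgroup_centralizer by auto
        then show "c \<otimes> x \<in> centralizer x"
          by (simp add: subgroup.m_closed)
        show "c \<otimes> x \<notin> center"
        proof
          assume *: "c \<otimes> x \<in> center"
          have "g \<otimes> x = x \<otimes> g" if g: "g \<in> carrier G" for g
          proof -
            have "c \<otimes> (g \<otimes> x) = g \<otimes> (c \<otimes> x)"
              using c cc g x by (simp add: center_def flip: m_assoc)
            also have "\<dots> = c \<otimes> (x \<otimes> g)"
              using * cc g x by (simp add: center_def m_assoc)
            finally show ?thesis
              using cc g x by simp
          qed
          with x show False by (auto simp: center_def)
        qed
      qed
    qed (use finA in simp)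
    then have za: "2 * z \<le> a" "z \<le> a"
      using center_sub[of x] x fin_sub[OF center_carrier]
      by (auto simp: card_Diff_subset z_def a_def)
    have eq: "card (S x) * a = n * (a - z)"
      using card_S[OF x] by (simp add: a_def)
    have "a > 0" using za z_pos by simp
    have "n * a \<le> n * (2 * (a - z))"
      using za by (intro mult_le_mono2) simp
    also have "\<dots> = 2 * card (S x) * a"
      using eq by simp
    finally have 1: "n \<le> 2 * card (S x)"
      using \<open>a > 0\<close> by simp
    have "a * z < n * z" using an z_pos by simp
    then have "n * a - n * z < n * a - a * z"
      using an za by (intro diff_less_mono2) (auto intro: mult_strict_mono le_less_trans)
    then have "card (S x) * a < (n - z) * a"
      using eq by (simp add: algebra_simps)
    with 1 show ?thesis by simp
  qed
  obtain x where x: "x \<in> carrier G - center"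
    using noncomm center_carrier by blast
  have card_nc: "card (carrier G - center) = n - z"
    using center_carrier fin_sub[OF center_carrier] by (simp add: card_Diff_subset n_def z_def)
  have "S x \<noteq> carrier G - center"
    using bounds[OF x] card_nc by auto
  then obtain y where y: "y \<in> carrier G - center" "y \<notin> S x"
    using S_sub[of x] by blast
  \<comment> \<open>If the two sets met, some conjugate of \<open>y\<close> would lie in
    \<open>centralizer x\<close>, which would put \<open>y\<close> into \<open>S x\<close>.\<close>
  have "S x \<inter> S y = {}"
  proof (rule ccontr)
    assume "S x \<inter> S y \<noteq> {}"
    then obtain g a h b where g: "g \<in> carrier G" and h: "h \<in> carrier G"
      and a: "a \<in> centralizer x" "a \<notin> center" and b: "b \<in> centralizer y" "b \<notin> center"
      and s: "conjugate g a = conjugate h b"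
      by (auto simp: S_def)
    have ac: "a \<in> carrier G" and bc: "b \<in> carrier G"
      using a b centralizer_sub by blast+
    define k where "k = inv g \<otimes> h"
    have k: "k \<in> carrier G" "h = g \<otimes> k"
      using g h by (auto simp: k_def simp flip: m_assoc)
    have kb: "conjugate k b = a"
      using s g k ac bc by (simp add: conjugate_inject flip: conjugate_conjugate)
    have Ca: "centralizer a = centralizer x" and Cb: "centralizer b = centralizer y"
      using eq[of x a] eq[of y b] x y a b ac bc by simp_all
    have "y \<in> centralizer b"
      using Cb y self by auto
    then have "conjugate k y \<in> centralizer x"
      using centralizer_conjugate_iff[of k y b] k y bc kb Ca by auto
    moreover have "conjugate k y \<notin> center" "y = conjugate (inv k) (conjugate k y)"
      using k y by (auto simp: conjugate_mem_center_iff)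
    ultimately have "y \<in> S x"
      unfolding S_def using k by (intro image_eqI[of _ _ "(inv k, conjugate k y)"]) auto
    with y show False by blast
  qed
  moreover have "finite (S x)" "finite (S y)"
    using S_sub fin_sub by blast+
  ultimately have "card (S x) + card (S y) = card (S x \<union> S y)"
    by (simp add: card_Un_disjoint)
  also have "\<dots> \<le> n - z"
    unfolding card_nc[symmetric] using S_sub fin by (intro card_mono) auto
  \<comment> \<open>Each of the two disjoint sets has at least \<open>n / 2\<close> elements, but
    together they fit into \<open>n - z < n\<close> elements.\<close>
  finally show False
    using bounds[OF x] bounds[OF y(1)] z_pos zn by linarith
qed

text \<open>If the group is not abelian, a normal centralizer of a noncentral \<open>x\<close> is
  generated by some \<open>a\<close>. Every conjugate of \<open>a\<close> is then a power of
  \<open>a\<close>, so coprimality makes \<open>a\<close> central, and with it its power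
  \<open>x\<close>, a contradiction.\<close>

lemma cyclic_if_proper_subgroups_cyclic:
  assumes fin: "finite (carrier G)" and cop: "coprime (order G) (totient (order G))"
    and cyc: "\<And>H. subgroup H G \<Longrightarrow> H \<noteq> carrier G \<Longrightarrow> \<exists>x\<in>H. \<forall>y\<in>H. \<exists>k::nat. y = x [^] k"
  shows "\<exists>x\<in>carrier G. \<forall>y\<in>carrier G. \<exists>k::nat. y = x [^] k"
proof -
  have proper: "x \<otimes> y = y \<otimes> x"
    if H: "subgroup H G" "H \<noteq> carrier G" and xy: "x \<in> H" "y \<in> H" for H x y
  proof -
    obtain a where "a \<in> H" and a: "\<forall>y\<in>H. \<exists>k::nat. y = a [^] k"
      using cyc[OF H] by blast
    have ac: "a \<in> carrier G"
      using \<open>a \<in> H\<close> H(1) subgroup.mem_carrier by fast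
    obtain i j :: nat where "x = a [^] i" "y = a [^] j"
      using a xy by meson
    then show ?thesis
      using ac by (simp add: nat_pow_mult add.commute)
  qed
  have "center = carrier G"
  proof (rule ccontr)
    assume "center \<noteq> carrier G"
    then have "\<exists>x\<in>carrier G - center.
        \<forall>g\<in>carrier G. \<forall>a\<in>centralizer x. conjugate g a \<in> centralizer x"
      using fin proper by (intro exists_noncentral_normal_centralizer)
    then obtain x where x: "x \<in> carrier G" "x \<notin> center"
      and normal: "\<And>g a. g \<in> carrier G \<Longrightarrow> a \<in> centralizer x \<Longrightarrow> conjugate g a \<in> centralizer x"
      by blast
    have "centralizer x \<noteq> carrier G"
      using x by (force simp: centralizer_def center_def)
    then obtain a where a: "a \<in> centralizer x" and gen: "\<forall>y\<in>centralizer x. \<exists>k::nat. y = a [^] k"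
      using cyc[OF subgroup_centralizer] x by blast
    have ac: "a \<in> carrier G"
      using a by (simp add: centralizer_def)
    have "conjugate g a = a" if g: "g \<in> carrier G" for g
    proof -
      obtain k :: nat where "conjugate g a = a [^] k"
        using normal[OF g a] gen by blast
      then show ?thesis
        \<comment> \<open>\<open>ord a\<close> divides the group order, so
          \<open>totient (ord a)\<close> divides the totient of that order and inherits
          coprimality.\<close>
        using cop totient_dvd[OF ord_dvd_group_order[OF ac]] coprime_divisors[OF dvd_refl]
        by (intro conjugate_eq_self_if_coprime_totient fin g ac)
    qed
    moreover obtain k :: nat where "x = a [^] k"
      using gen x by (auto simp: centralizer_def)
    ultimately have "conjugate g x = x" if "g \<in> carrier G" for g
      using that ac by (simp add: conjugate_pow)
    then have "x \<in> center"
      using x conjugate_eq_self_iff by (auto simp: center_def centralizer_def)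
    with x show False by blast
  qed
  then interpret comm_group G
    by unfold_locales (auto simp: center_def)
  obtain x where x: "x \<in> carrier G" "ord x = order G"
    using exists_ord_eq_order_if_squarefree[OF fin squarefree_if_coprime_totient[OF cop]]
    by blast
  have "carrier G = {x [^] k | k. k \<in> (UNIV :: nat set)}"
  proof -
    have "card (generate G {x}) = card (carrier G)"
      using x generate_pow_card[of x] by (simp add: order_def)
    moreover have "generate G {x} \<subseteq> carrier G"
      using x by (intro generate_incl) auto
    ultimately have "generate G {x} = carrier G"
      using fin by (simp add: card_subset_eq)
    then show ?thesis
      using generate_pow_nat[of x] x fin by (auto simp: order_gt_0_iff_finite)
  qed
  with x(1) show ?thesis by blast
qed

end

text \<open>Strong induction on the order: coprimality with the totient passes to divisors, hence by
  Lagrange to the orders of subgroups.\<close>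

lemma cyclic_if_coprime_order_totient:
  assumes "group G" "finite (carrier G)" "coprime (order G) (totient (order G))"
  shows "\<exists>x\<in>carrier G. \<forall>y\<in>carrier G. \<exists>k::nat. y = x [^]\<^bsub>G\<^esub> k"
  using assms
proof (induction "order G" arbitrary: G rule: less_induct)
  case less
  interpret group G by fact
  have fin: "finite (carrier G)" by fact
  show ?case
  proof (rule cyclic_if_proper_subgroups_cyclic[OF fin less.prems(3)])
    fix H assume H: "subgroup H G" "H \<noteq> carrier G"
    then have "H \<subset> carrier G"
      using subgroup.subset by blast
    then have "card H < order G"
      using fin by (simp add: order_def psubset_card_mono)
    moreover have "group (G\<lparr>carrier := H\<rparr>)"
      using H(1) by (rule subgroup.subgroup_is_group) (rule is_group)
    moreover have "card H dvd order G"
      using lagrange[OF H(1)] by (metis dvd_triv_right)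
    then have "coprime (card H) (totient (card H))"
      using less.prems(3) totient_dvd by (meson coprime_divisors)
    moreover have "finite H"
      using \<open>H \<subset> carrier G\<close> fin finite_subset by blast
    ultimately show "\<exists>x\<in>H. \<forall>y\<in>H. \<exists>k::nat. y = x [^]\<^bsub>G\<^esub> k"
      using less.hyps[of "G\<lparr>carrier := H\<rparr>"]
      by (simp add: order_def flip: nat_pow_consistent)
  qed
qed

section \<open>Noncyclic semidirect products\<close>

section \<open>Noncyclic groups\<close>

text \<open>The semidirect product of \<open>\<int>/m\<close> by \<open>\<int>/p\<close>, with \<open>(a, i)\<close> standing for the map
  \<open>x \<mapsto> u\<^sup>i x + a\<close>.\<close>
definition affine_group :: "nat \<Rightarrow> nat \<Rightarrow> nat \<Rightarrow> (nat \<times> nat) monoid" where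
  "affine_group m p u =
     \<lparr>carrier = {..<m} \<times> {..<p},
      mult = (\<lambda>(a, i) (b, j). ((a + u ^ i * b) mod m, (i + j) mod p)),
      one = (0, 0)\<rparr>"

lemma affine_group_simps [simp]:
  "carrier (affine_group m p u) = {..<m} \<times> {..<p}"
  "(a, i) \<otimes>\<^bsub>affine_group m p u\<^esub> (b, j) = ((a + u ^ i * b) mod m, (i + j) mod p)"
  "\<one>\<^bsub>affine_group m p u\<^esub> = (0, 0)"
  by (simp_all add: affine_group_def)

lemma order_affine_group: "order (affine_group m p u) = m * p"
  by (simp add: order_def card_cartesian_product)

lemma group_affine_group:
  assumes "m > 0" "p > 0" "[u ^ p = 1] (mod m)"
  shows "group (affine_group m p u)"
proof (rule groupI)
  have mod_cong: "[k mod m = k] (mod m)" for k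
    by (simp add: cong_def)
  \<comment> \<open>Since \<open>u ^ p\<close> is 1 modulo \<open>m\<close>, reducing exponents
    modulo \<open>p\<close> is harmless; associativity rests on this.\<close>
  have pow_mod: "[u ^ (k mod p) = u ^ k] (mod m)" for k
  proof -
    have "[(u ^ p) ^ (k div p) * u ^ (k mod p) = 1 ^ (k div p) * u ^ (k mod p)] (mod m)"
      by (intro cong_mult cong_pow assms cong_refl)
    moreover have "(u ^ p) ^ (k div p) * u ^ (k mod p) = u ^ k"
      by (simp flip: power_mult power_add)
    ultimately show ?thesis
      by (simp add: cong_sym)
  qed
  fix x y z
  assume "x \<in> carrier (affine_group m p u)" "y \<in> carrier (affine_group m p u)"
    "z \<in> carrier (affine_group m p u)"
  then obtain a i b j c k where x: "x = (a, i)" "a < m" "i < p" and y: "y = (b, j)" and z: "z = (c, k)"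
    by auto
  have "[(a + u ^ i * b) mod m + u ^ ((i + j) mod p) * c = (a + u ^ i * b) + u ^ (i + j) * c] (mod m)"
    by (intro cong_add cong_mult pow_mod cong_refl mod_cong)
  also have "(a + u ^ i * b) + u ^ (i + j) * c = a + u ^ i * (b + u ^ j * c)"
    by (simp add: algebra_simps power_add)
  also have "[\<dots> = a + u ^ i * ((b + u ^ j * c) mod m)] (mod m)"
    by (intro cong_add cong_mult cong_refl cong_sym[OF mod_cong])
  finally show "x \<otimes>\<^bsub>affine_group m p u\<^esub> y \<otimes>\<^bsub>affine_group m p u\<^esub> z =
      x \<otimes>\<^bsub>affine_group m p u\<^esub> (y \<otimes>\<^bsub>affine_group m p u\<^esub> z)"
    by (simp add: x y z cong_def mod_simps add.assoc)
  \<comment> \<open>The inverse of \<open>(a, i)\<close> is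
    \<open>(- u ^ (p - i) * a, p - i)\<close>, as \<open>u ^ (p - i)\<close> inverts
    \<open>u ^ i\<close>. The outer reductions matter when the subtracted residue or
    \<open>i\<close> is 0.\<close>
  let ?b = "(m - u ^ (p - i) * a mod m) mod m" and ?j = "(p - i) mod p"
  have "[(m - u ^ (p - i) * a mod m) mod m + u ^ ?j * a =
      (m - u ^ (p - i) * a mod m) + u ^ (p - i) * a mod m] (mod m)"
    by (intro cong_add cong_trans[OF cong_mult[OF pow_mod cong_refl]] mod_cong cong_refl
        cong_sym[OF mod_cong])
  moreover have "u ^ (p - i) * a mod m \<le> m"
    using assms(1) by (simp add: less_imp_le)
  ultimately have "(?b + u ^ ?j * a) mod m = 0"
    by (simp add: cong_def)
  moreover have "(?j + i) mod p = 0"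
    using x by (simp add: mod_simps)
  ultimately have "(?b, ?j) \<otimes>\<^bsub>affine_group m p u\<^esub> x = \<one>\<^bsub>affine_group m p u\<^esub>"
    by (simp add: x)
  then show "\<exists>y\<in>carrier (affine_group m p u). y \<otimes>\<^bsub>affine_group m p u\<^esub> x = \<one>\<^bsub>affine_group m p u\<^esub>"
    using assms by (intro bexI[of _ "(?b, ?j)"]) auto
qed (use assms in auto)

text \<open>Cauchy's theorem in the unit group modulo \<open>m\<close>, which has order
  \<open>totient m\<close>.\<close>

lemma exists_nontrivial_root_of_unity_mod:
  assumes "Factorial_Ring.prime p" "p dvd totient m" "m > 0"
  shows "\<exists>u. [u ^ p = 1] (mod m) \<and> \<not> [u = 1] (mod m)"
proof -
  have "m \<noteq> 1"
    using assms(1,2) by auto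
  then interpret residues "int m" "residue_ring (int m)"
    using assms(3) by unfold_locales auto
  interpret U: group "units_of (residue_ring (int m))"
    by (rule units_group)
  obtain w where w: "w \<in> Units (residue_ring (int m))" and ord: "U.ord w = p"
    using U.exists_ord_eq_prime[OF _ assms(1)] assms(2) totient_eq
    by (auto simp: units_of_carrier order_def)
  have pow: "x [^]\<^bsub>units_of (residue_ring (int m))\<^esub> (k::nat) = x [^]\<^bsub>residue_ring (int m)\<^esub> k" for x k
    by (induction k) (simp_all add: nat_pow_def units_of_def)
  have w': "0 < w" "w < int m"
    using w by (auto simp: res_units_eq)
  have "w [^]\<^bsub>residue_ring (int m)\<^esub> p = 1"
    using U.pow_ord_eq_1[of w] w ord by (simp add: units_of_carrier units_of_one res_one_eq flip: pow)
  then have "[w ^ p = 1] (mod int m)"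
    using pow_cong[of w p] w' m_gt_one by (simp add: cong_def)
  moreover define u where "u = nat w"
  then have "w = int u" using w' by simp
  ultimately have "[u ^ p = 1] (mod m)"
    by (metis cong_int_iff of_nat_1 of_nat_power)
  moreover have "\<not> [u = 1] (mod m)"
  proof
    assume "[u = 1] (mod m)"
    then have "w = \<one>\<^bsub>units_of (residue_ring (int m))\<^esub>"
      using w' m_gt_one \<open>w = int u\<close> by (simp add: cong_def units_of_one res_one_eq)
    then have "U.ord w = 1" by simp
    then show False
      using ord assms(1) by simp
  qed
  ultimately show ?thesis by blast
qed

lemma exists_noncyclic_group:
  assumes "n > 0" "\<not> coprime n (totient n)"
  shows "\<exists>G :: (nat \<times> nat) monoid. group G \<and> finite (carrier G) \<and> order G = n \<and>
    \<not> (\<exists>x\<in>carrier G. \<forall>y\<in>carrier G. \<exists>k::nat. y = x [^]\<^bsub>G\<^esub> k)"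
proof -
  have "gcd n (totient n) \<noteq> 1"
    using assms(2) by (simp add: coprime_iff_gcd_eq_1)
  then obtain p where p: "Factorial_Ring.prime p" "p dvd gcd n (totient n)"
    using prime_factor_nat by blast
  then obtain m where m: "n = m * p"
    by (metis dvdE gcd_nat.bounded_iff mult.commute)
  have "m > 0" using m assms by simp
  have "p > 1" using p(1) by (rule prime_gt_1_nat)
  show ?thesis
  proof (cases "p dvd m")
    case True
    \<comment> \<open>With \<open>u = 1\<close> this is the direct product of the two cyclic
      groups.\<close>
    let ?G = "affine_group m p (Suc 0)"
    have G: "group ?G"
      using \<open>m > 0\<close> \<open>p > 1\<close> by (intro group_affine_group) auto
    have "m > 1"
      using True \<open>m > 0\<close> \<open>p > 1\<close> by (meson dvd_imp_le less_le_trans)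
    have pow: "(a, i) [^]\<^bsub>?G\<^esub> k = (k * a mod m, k * i mod p)" for a i k
      by (induction k) (simp_all add: nat_pow_def mod_simps add.commute)
    have "\<not> (\<exists>x\<in>carrier ?G. \<forall>y\<in>carrier ?G. \<exists>k::nat. y = x [^]\<^bsub>?G\<^esub> k)"
    proof
      assume "\<exists>x\<in>carrier ?G. \<forall>y\<in>carrier ?G. \<exists>k::nat. y = x [^]\<^bsub>?G\<^esub> k"
      then obtain a i where gen: "\<forall>y\<in>{..<m} \<times> {..<p}. \<exists>k::nat. y = (a, i) [^]\<^bsub>?G\<^esub> k"
        by auto
      from gen[rule_format, of "(1, 0)"] obtain k where k: "k * a mod m = 1" "k * i mod p = 0"
        using \<open>m > 1\<close> \<open>p > 1\<close> by (auto simp: pow)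
      from gen[rule_format, of "(0, 1)"] obtain l where l: "l * i mod p = 1"
        using \<open>m > 1\<close> \<open>p > 1\<close> by (auto simp: pow)
      \<comment> \<open>\<open>p\<close> divides \<open>m\<close> and \<open>k * a\<close> is 1
        modulo \<open>m\<close>, so \<open>p\<close> cannot divide \<open>k\<close>. Then
        \<open>k * i\<close> being 0 modulo \<open>p\<close> forces \<open>p\<close> to divide
        \<open>i\<close>, and no power of \<open>(a, i)\<close> has second component 1.\<close>
      have "\<not> p dvd k"
      proof
        assume "p dvd k"
        then have "p dvd k * a mod m"
          using True by (simp add: dvd_mod)
        then show False
          using k \<open>p > 1\<close> by simp
      qed
      then have "p dvd i"
        using k(2) p(1) by (auto simp: prime_dvd_mult_iff simp flip: dvd_eq_mod_eq_0)
      then show False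
        using l by auto
    qed
    then show ?thesis
      using G m order_affine_group[of m p "Suc 0"] by (intro exI[of _ ?G]) auto
  next
    case False
    then have cop: "coprime m p"
      using p(1) prime_imp_coprime coprime_commute by blast
    have "p dvd totient m * (p - 1)"
      using p m totient_mult_coprime[OF cop] by (simp add: totient_prime)
    moreover have "\<not> p dvd p - 1"
      using \<open>p > 1\<close> by (auto dest: dvd_imp_le)
    ultimately have "p dvd totient m"
      using p(1) prime_dvd_mult_iff by blast
    then obtain u where u: "[u ^ p = 1] (mod m)" "\<not> [u = 1] (mod m)"
      using exists_nontrivial_root_of_unity_mod p(1) \<open>m > 0\<close> by blast
    let ?G = "affine_group m p u"
    interpret group ?G
      using \<open>m > 0\<close> \<open>p > 1\<close> u by (intro group_affine_group) auto
    have "m \<noteq> 1" using u by auto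
    then have "m > 1" using \<open>m > 0\<close> by simp
    have "\<not> (\<exists>x\<in>carrier ?G. \<forall>y\<in>carrier ?G. \<exists>k::nat. y = x [^]\<^bsub>?G\<^esub> k)"
    proof
      assume "\<exists>x\<in>carrier ?G. \<forall>y\<in>carrier ?G. \<exists>k::nat. y = x [^]\<^bsub>?G\<^esub> k"
      then obtain x where x: "x \<in> carrier ?G" and gen: "\<forall>y\<in>carrier ?G. \<exists>k::nat. y = x [^]\<^bsub>?G\<^esub> k"
        by blast
      obtain k l :: nat where "(1, 0) = x [^]\<^bsub>?G\<^esub> k" "(0, 1) = x [^]\<^bsub>?G\<^esub> l"
        using gen[rule_format, of "(1, 0)"] gen[rule_format, of "(0, 1)"] \<open>m > 1\<close> \<open>p > 1\<close> by auto
      \<comment> \<open>Powers of one element commute, but the two products here have first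
        components 1 and \<open>u\<close> modulo \<open>m\<close>.\<close>
      then have "(1, 0) \<otimes>\<^bsub>?G\<^esub> (0, 1) = (0, 1) \<otimes>\<^bsub>?G\<^esub> (1, 0)"
        using x by (simp only: nat_pow_mult add.commute)
      then show False
        using u(2) by (simp add: cong_def)
    qed
    then show ?thesis
      using is_group m order_affine_group[of m p u] by (intro exI[of _ ?G]) auto
  qed
qed

section \<open>Passing between abstract groups and transformation groups\<close>

section \<open>Transformation groups\<close>

lemma group_if_transformation_group:
  assumes "transformation_group X T"
  shows "group \<lparr>carrier = T, mult = (\<circ>), one = id\<rparr>" (is "group ?G")
proof (rule groupI)
  have inv: "Hilbert_Choice.inv f \<circ> f = id" if "f \<in> T" for f
    using assms that permutes_inv_o(2)[of f X] by (auto simp: transformation_group_def)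
  obtain f where "f \<in> T"
    using assms by (auto simp: transformation_group_def)
  then have "Hilbert_Choice.inv f \<circ> f \<in> T"
    using assms by (auto simp: transformation_group_def)
  then show "\<one>\<^bsub>?G\<^esub> \<in> carrier ?G"
    using inv \<open>f \<in> T\<close> by simp
  fix g assume "g \<in> carrier ?G"
  then show "\<exists>h\<in>carrier ?G. h \<otimes>\<^bsub>?G\<^esub> g = \<one>\<^bsub>?G\<^esub>"
    using assms inv
    by (intro bexI[of _ "Hilbert_Choice.inv g"]) (auto simp: transformation_group_def)
qed (use assms in \<open>auto simp: transformation_group_def comp_assoc\<close>)

lemma funpow_eq_nat_pow:
  "g ^^ k = g [^]\<^bsub>\<lparr>carrier = T, mult = (\<circ>), one = id\<rparr>\<^esub> k"
  by (induction k) (simp_all add: nat_pow_def funpow_Suc_right del: funpow.simps(2))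

text \<open>The left regular representation, transported along a bijection \<open>e\<close> to a
  subset of \<open>'a\<close>; infinity of the type provides a subset of the right size.\<close>

lemma cayley:
  fixes G (structure)
  assumes "group G" and fin: "finite (carrier G)" and inf: "infinite (UNIV :: 'a set)"
  shows "\<exists>(X :: 'a set) T. transformation_group X T \<and> card T = order G \<and>
    (cyclic_transformation_group T \<longrightarrow> (\<exists>x\<in>carrier G. \<forall>y\<in>carrier G. \<exists>k::nat. y = x [^] k))"
proof -
  interpret group G by fact
  obtain X :: "'a set" where X: "finite X" "card X = order G"
    using infinite_arbitrarily_large[OF inf] by blast
  have "card (carrier G) = card X"
    using X by (simp add: order_def)
  then obtain e where e: "bij_betw e (carrier G) X"
    using finite_same_card_bij fin X(1) by blast
  define d where "d = inv_into (carrier G) e"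
  have eX: "e g \<in> X" if "g \<in> carrier G" for g
    using e that bij_betwE by blast
  have dX: "d t \<in> carrier G" "e (d t) = t" if "t \<in> X" for t
    using e that unfolding d_def
    by (auto simp: bij_betw_inv_into_right bij_betw_def inv_into_into)
  have de: "d (e g) = g" if "g \<in> carrier G" for g
    using e that unfolding d_def by (simp add: bij_betw_inv_into_left)
  \<comment> \<open>Left multiplication by \<open>g\<close> read on \<open>X\<close>, extended by
    the identity as \<open>permutes\<close> demands.\<close>
  define L where "L g t = (if t \<in> X then e (g \<otimes> d t) else t)" for g t
  have L_mult: "L g \<circ> L h = L (g \<otimes> h)" if "g \<in> carrier G" "h \<in> carrier G" for g h
    using that by (auto simp: L_def fun_eq_iff eX dX de m_assoc)
  have L_one: "L \<one> = id"
    by (auto simp: L_def fun_eq_iff dX)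
  have L_inv: "L (inv g) \<circ> L g = id" "L g \<circ> L (inv g) = id" if "g \<in> carrier G" for g
    using that by (simp_all add: L_mult L_one)
  have inv_L: "Hilbert_Choice.inv (L g) = L (inv g)" if "g \<in> carrier G" for g
    using L_inv[OF that] by (metis inv_unique_comp)
  have perm: "L g permutes X" if "g \<in> carrier G" for g
    unfolding permutes_def
  proof (intro conjI allI impI)
    fix t show "\<exists>!s. L g s = t"
      using L_inv[OF that] by (metis comp_apply id_apply)
  qed (simp add: L_def)
  have L_pow: "L g ^^ k = L (g [^] k)" if "g \<in> carrier G" for g and k :: nat
  proof (induction k)
    case (Suc k)
    then show ?case
      using that nat_pow_Suc2[OF that, of k] by (simp add: L_mult)
  qed (simp add: L_one)
  have L_inj: "inj_on L (carrier G)"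
  proof (rule inj_onI)
    fix g h assume g: "g \<in> carrier G" "h \<in> carrier G" and "L g = L h"
    \<comment> \<open>The point \<open>e \<one>\<close> recovers \<open>g\<close> from
      \<open>L g\<close>.\<close>
    then have "L g (e \<one>) = L h (e \<one>)" by simp
    then have "e g = e h"
      using g by (simp add: L_def eX de)
    then show "g = h"
      using g de by metis
  qed
  have "transformation_group X (L ` carrier G)"
    unfolding transformation_group_def
    using perm by (auto simp: L_mult inv_L)
  moreover have "card (L ` carrier G) = order G"
    using L_inj by (simp add: card_image order_def)
  moreover have "\<exists>x\<in>carrier G. \<forall>y\<in>carrier G. \<exists>k::nat. y = x [^] k"
    if cyc: "cyclic_transformation_group (L ` carrier G)"
  proof -
    obtain x where x: "x \<in> carrier G" and gen: "L ` carrier G = {L x ^^ k | k. k \<ge> 1}"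
      using cyc by (auto simp: cyclic_transformation_group_def)
    have "\<exists>k::nat. y = x [^] k" if y: "y \<in> carrier G" for y
    proof -
      obtain k where "L y = L x ^^ k"
        using gen y by blast
      then have "L y = L (x [^] k)"
        using x by (simp add: L_pow)
      then show ?thesis
        using L_inj x y by (auto dest: inj_onD)
    qed
    with x show ?thesis by blast
  qed
  ultimately show ?thesis by blast
qed

theorem mainTheorem1:
  fixes n :: nat
  assumes "n > 0"
    and "infinite (UNIV :: 'a set)"
  shows "(\<forall>(X :: 'a set) G. transformation_group X G \<and> card G = n
            \<longrightarrow> cyclic_transformation_group G)
         \<longleftrightarrow> coprime n (totient n)"
proof
  assume all: "\<forall>(X :: 'a set) G. transformation_group X G \<and> card G = n
    \<longrightarrow> cyclic_transformation_group G"
  show "coprime n (totient n)"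
  proof (rule ccontr)
    assume "\<not> coprime n (totient n)"
    then obtain G :: "(nat \<times> nat) monoid" where "group G" "finite (carrier G)" "order G = n"
      and "\<not> (\<exists>x\<in>carrier G. \<forall>y\<in>carrier G. \<exists>k::nat. y = x [^]\<^bsub>G\<^esub> k)"
      using exists_noncyclic_group assms(1) by blast
    with all show False
      using cayley[of G] assms(2) by blast
  qed
next
  assume cop: "coprime n (totient n)"
  show "\<forall>(X :: 'a set) G. transformation_group X G \<and> card G = n
    \<longrightarrow> cyclic_transformation_group G"
  proof (intro allI impI, elim conjE)
    fix X :: "'a set" and T
    assume T: "transformation_group X T" and n: "card T = n"
    let ?G = "\<lparr>carrier = T, mult = (\<circ>), one = id\<rparr>"
    interpret group ?G
      using T by (rule group_if_transformation_group)
    \<comment> \<open>An infinite \<open>T\<close> would have \<open>card T = 0\<close>, against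
      \<open>n > 0\<close>.\<close>
    have "finite T"
      using n assms(1) card_ge_0_finite by blast
    then obtain g where g: "g \<in> T" and gen: "\<forall>f\<in>T. \<exists>k. f = g ^^ k"
      using cyclic_if_coprime_order_totient[of ?G] is_group cop n
      by (auto simp: order_def simp flip: funpow_eq_nat_pow)
    have closed: "g ^^ k \<in> T" for k
      using nat_pow_closed[of g k] g by (simp flip: funpow_eq_nat_pow)
    have "g ^^ n = id"
      using pow_order_eq_1[of g] g n by (simp add: order_def flip: funpow_eq_nat_pow)
    \<comment> \<open>Cyclicity lists only positive powers, so the exponent 0 is replaced by
      \<open>n\<close>.\<close>
    then have shift: "g ^^ (k + n) = g ^^ k" for k
      by (simp add: funpow_add)
    have "f \<in> {g ^^ k | k. k \<ge> 1}" if f: "f \<in> T" for f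
    proof -
      obtain k where "f = g ^^ k"
        using gen f by blast
      then have "f = g ^^ (k + n)"
        by (simp add: shift)
      then show ?thesis
        using assms(1) by (intro CollectI exI[of _ "k + n"]) simp
    qed
    then have "T = {g ^^ k | k. k \<ge> 1}"
      using closed by blast
    then show "cyclic_transformation_group T"
      unfolding cyclic_transformation_group_def using g by blast
  qed
qed

end
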